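(* Let $1<p<\infty$, $\alpha>-1$, and let $\varphi$ be a nonnegative measurable function on $(0,\infty)$ such that $\int_0^\infty t^{\frac{1+\alpha}{p}-1}|\varphi(t)|\,dt<\infty$. Then $\mathcal H_\varphi$ is bounded on $L^p_{|\cdot|^\alpha}(\mathbb R)$; moreover, $$\|\mathcal H_\varphi\|_{L^p_{|\cdot|^\alpha}(\mathbb R)\to L^p_{|\cdot|^\alpha}(\mathbb R)}=\int_0^\infty t^{\frac{1+\alpha}{p}-1}\varphi(t)\,dt.$$
   Context: For a measurable function $\varphi$ on $(0,\infty)$, the real Hausdorff operator is defined for suitable measurable functions $f$ on $\mathbb R$ by $\mathcal H_\varphi(f)(x)=\int_0^\infty f\left(\frac xt\right)\frac{\varphi(t)}{t}\,dt$, $x\in\mathbb R$. $L^p_{|\cdot|^\alpha}(\mathbb R)$ is the (complex-valued) $L^p$ space on $\mathbb R$ with respect to the measure $|x|^\alpha dx$, with norm $\|f\|_{L^p_{|\cdot|^\alpha}(\mathbb R)}=\left(\int_{\mathbb R}|f(x)|^p|x|^\alpha\,dx\right)^{1/p}$. $\|\cdot\|_{X\to X}$ denotes the operator norm on a normed space $X$. *)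

theory Defs
  imports "HOL-Analysis.Analysis"
begin

text \<open>
  Elements of \<open>L\<^sup>p(M)\<close> are represented by functions. Equality in the space is equality almost
  everywhere, so \<open>Lp_norm\<close> is a norm on the classes and only a seminorm on representatives.
\<close>

definition Lp_space :: "real \<Rightarrow> 'a measure \<Rightarrow> ('a \<Rightarrow> complex) set" where
  "Lp_space p M = {f \<in> borel_measurable M. integrable M (\<lambda>x. norm (f x) powr p)}"

definition Lp_norm :: "real \<Rightarrow> 'a measure \<Rightarrow> ('a \<Rightarrow> complex) \<Rightarrow> real" where
  "Lp_norm p M f = (LINT x|M. norm (f x) powr p) powr (1 / p)"

text \<open>
  The second conjunct says that \<open>T\<close> descends to classes modulo equality almost everywhere; the
  third and fourth are linearity of the induced operator.
\<close>

definition bounded_on_Lp :: "real \<Rightarrow> 'a measure \<Rightarrow> (('a \<Rightarrow> complex) \<Rightarrow> 'a \<Rightarrow> complex) \<Rightarrow> bool" where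
  "bounded_on_Lp p M T \<longleftrightarrow>
     (\<forall>f \<in> Lp_space p M. T f \<in> Lp_space p M) \<and>
     (\<forall>f \<in> Lp_space p M. \<forall>g \<in> Lp_space p M.
        (AE x in M. f x = g x) \<longrightarrow> (AE x in M. T f x = T g x)) \<and>
     (\<forall>f \<in> Lp_space p M. \<forall>g \<in> Lp_space p M.
        AE x in M. T (\<lambda>y. f y + g y) x = T f x + T g x) \<and>
     (\<forall>c. \<forall>f \<in> Lp_space p M. AE x in M. T (\<lambda>y. c * f y) x = c * T f x) \<and>
     (\<exists>C. \<forall>f \<in> Lp_space p M. Lp_norm p M (T f) \<le> C * Lp_norm p M f)"

text \<open>
  The analogue of \<^const>\<open>onorm\<close>, likewise meaningful only for bounded operators: the supremum is
  taken in the reals, and classes of norm zero contribute \<open>0 / 0 = 0\<close>.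
\<close>

definition Lp_onorm :: "real \<Rightarrow> 'a measure \<Rightarrow> (('a \<Rightarrow> complex) \<Rightarrow> 'a \<Rightarrow> complex) \<Rightarrow> real" where
  "Lp_onorm p M T = (SUP f \<in> Lp_space p M. Lp_norm p M (T f) / Lp_norm p M f)"

text \<open>
  The measure \<open>\<bar>x\<bar>\<^sup>\<alpha> dx\<close> on the real line. Here \<open>0 powr \<alpha> = 0\<close> for every \<open>\<alpha>\<close>, which
  affects the density only on a null set.
\<close>

definition power_weight :: "real \<Rightarrow> real measure" where
  "power_weight \<alpha> = density lebesgue (\<lambda>x. ennreal (\<bar>x\<bar> powr \<alpha>))"

definition hausdorff_integrand ::
    "(real \<Rightarrow> real) \<Rightarrow> (real \<Rightarrow> complex) \<Rightarrow> real \<Rightarrow> real \<Rightarrow> complex" where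
  "hausdorff_integrand \<phi> f x t = f (x / t) * complex_of_real (\<phi> t / t)"

text \<open>
  The value is the intended one only where the integrand is integrable; elsewhere the library
  integral is \<open>0\<close>. Values of \<open>\<phi>\<close> outside \<open>(0, \<infinity>)\<close> are irrelevant.
\<close>

definition hausdorff_op :: "(real \<Rightarrow> real) \<Rightarrow> (real \<Rightarrow> complex) \<Rightarrow> real \<Rightarrow> complex" where
  "hausdorff_op \<phi> f x = (LINT t:{0<..}|lebesgue. hausdorff_integrand \<phi> f x t)"

end

theory Submission
  imports Defs
begin

text \<open>
  Write \<open>\<gamma> = (1 + \<alpha>) / p\<close> and let \<open>A\<close> be the integral of the weight \<open>a(t) = t\<^sup>\<gamma>\<^sup>-\<^sup>1 \<phi>(t)\<close>. For the
  upper bound, write the integrand as \<open>a(t)\<close> times \<open>t\<^sup>-\<^sup>\<gamma> \<bar>f(x/t)\<bar>\<close> and apply Jensen's inequality for the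
  finite measure \<open>a(t) dt\<close>; by Tonelli and the substitution \<open>x = t y\<close>, integrating the result against
  \<open>\<bar>x\<bar>\<^sup>\<alpha> dx\<close> gives \<open>A\<^sup>p\<close> times the \<open>p\<close>-th power of the norm of \<open>f\<close>. Tonelli needs measurability on
  a product of Borel measures, so \<open>f\<close> and \<open>\<phi>\<close> are first replaced by Borel versions; for
  \<open>x \<noteq> 0\<close> this does not change the operator, since \<open>t \<mapsto> x/t\<close> preserves null sets.

  For the lower bound, test with \<open>f(x) = x\<^sup>-\<^sup>\<gamma>\<close> on \<open>[1, R]\<close>, for which the \<open>p\<close>-th power of the norm is
  \<open>ln R\<close>. On \<open>[N, R/N]\<close> its image is at least \<open>x\<^sup>-\<^sup>\<gamma>\<close> times the integral of \<open>a\<close> over \<open>[1/N, N]\<close>.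
  Take \<open>N = e\<^sup>n\<close> and \<open>R = e\<close> to the power \<open>n\<^sup>2\<close>, and let \<open>n\<close> tend to infinity.
\<close>

subsection \<open>Jensen's inequality, null sets and scaling\<close>

text \<open>The function y^p lies above its tangent at the \<open>a\<close>-weighted mean of
  \<open>h\<close>; integrating the tangent inequality against \<open>a\<close> gives the bound. As
  \<open>a\<close> is not normalised, its total mass enters with exponent p - 1.\<close>

lemma weighted_Jensen_powr:
  fixes a h :: "'a \<Rightarrow> real"
  assumes p: "1 < p"
    and [measurable]: "h \<in> borel_measurable M"
    and a: "integrable M a" "\<And>x. 0 \<le> a x"
    and h: "\<And>x. 0 \<le> h x"
    and ahp: "integrable M (\<lambda>x. a x * h x powr p)"
  shows "integrable M (\<lambda>x. a x * h x)"
    and "(LINT x|M. a x * h x) powr p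
           \<le> (LINT x|M. a x) powr (p - 1) * (LINT x|M. a x * h x powr p)"
proof -
  have [measurable]: "a \<in> borel_measurable M"
    using a(1) by auto
  \<comment> \<open>This dominates \<open>a x * h x\<close> by the sum of the two functions assumed
    integrable.\<close>
  have "h x \<le> 1 + h x powr p" for x
  proof (cases "h x \<le> 1")
    case False
    then have "h x powr 1 \<le> h x powr p"
      using p by (intro powr_mono) auto
    then show ?thesis using False by simp
  qed (simp add: add_increasing2)
  then have "a x * h x \<le> a x + a x * h x powr p" for x
    using mult_left_mono[OF _ a(2), of "h x" "1 + h x powr p" x] by (simp add: algebra_simps)
  then show ah: "integrable M (\<lambda>x. a x * h x)"
    using a h by (intro Bochner_Integration.integrable_bound[OF Bochner_Integration.integrable_add[OF a(1) ahp]])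
      (auto simp: abs_mult abs_of_nonneg)
  define A where "A = (LINT x|M. a x)"
  define H where "H = (LINT x|M. a x * h x)"
  define B where "B = (LINT x|M. a x * h x powr p)"
  have nonneg: "A \<ge> 0" "H \<ge> 0" "B \<ge> 0"
    unfolding A_def H_def B_def using a h by (auto intro!: integral_nonneg_AE)
  have "H powr p \<le> A powr (p - 1) * B"
  \<comment> \<open>The tangent point \<open>H / A\<close> has to exist and be positive, so that its
    powers can be cancelled later. If \<open>A = 0\<close>, then \<open>a\<close> vanishes almost
    everywhere and \<open>H = 0\<close> follows.\<close>
  proof (cases "H = 0 \<or> A = 0")
    case True
    moreover have "H = 0" if "A = 0"
    proof -
      have "AE x in M. a x = 0"
        using that a unfolding A_def by (subst (asm) integral_nonneg_eq_0_iff_AE) auto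
      then have "H = (LINT x|M. 0)"
        unfolding H_def by (intro integral_cong_AE) auto
      then show ?thesis by simp
    qed
    ultimately show ?thesis using nonneg by auto
  next
    case False
    then have pos: "A > 0" "H > 0" using nonneg by auto
    \<comment> \<open>The weighted mean of \<open>h\<close>. Because \<open>c * A = H\<close>, the
      constant and linear terms of the integrated tangent combine into a single multiple of
      \<open>c powr (p - 1) * H\<close>.\<close>
    define c where "c = H / A"
    have c: "c > 0" using pos by (simp add: c_def)
    define q where "q = p / (p - 1)"
    have q: "q > 1" "1 / p + 1 / q = 1"
      using p by (auto simp: q_def field_simps)
    \<comment> \<open>The tangent to y^p at c, obtained from Young's inequality for y and c^(p-1),
      where (p - 1) q = p.\<close>
    have "p * c powr (p - 1) * y \<le> y powr p + (p - 1) * c powr p" if "y \<ge> 0" for y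
    proof -
      have "y * c powr (p - 1) \<le> y powr p / p + (c powr (p - 1)) powr q / q"
        using Youngs_inequality[OF p q(1,2) that, of "c powr (p - 1)"] by simp
      also have "(c powr (p - 1)) powr q = c powr p"
        using p by (simp add: powr_powr q_def)
      finally have "p * (y * c powr (p - 1)) \<le> p * (y powr p / p + c powr p / q)"
        using p by (intro mult_left_mono) auto
      also have "\<dots> = y powr p + (p - 1) * c powr p"
        using p by (simp add: q_def field_simps)
      finally show ?thesis by (simp add: mult_ac)
    qed
    then have "a x * (p * c powr (p - 1) * h x) \<le> a x * (h x powr p + (p - 1) * c powr p)" for x
      using a h by (intro mult_left_mono) auto
    then have "(LINT x|M. p * c powr (p - 1) * (a x * h x))
        \<le> (LINT x|M. a x * h x powr p + ((p - 1) * c powr p) * a x)"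
    proof (intro integral_mono)
      show "integrable M (\<lambda>x. p * c powr (p - 1) * (a x * h x))"
        by (intro integrable_mult_right ah)
      show "integrable M (\<lambda>x. a x * h x powr p + ((p - 1) * c powr p) * a x)"
        by (intro Bochner_Integration.integrable_add integrable_mult_right ahp a)
    qed (simp add: algebra_simps)
    then have "p * c powr (p - 1) * H \<le> B + (p - 1) * (c powr p * A)"
      using ah ahp a by (simp add: H_def B_def A_def)
    also have "c powr p * A = c powr (p - 1) * H"
      using pos c by (simp add: c_def powr_diff)
    finally have "c powr (p - 1) * H \<le> B"
      by (simp add: algebra_simps)
    then have "A powr (p - 1) * (c powr (p - 1) * H) \<le> A powr (p - 1) * B"
      by (intro mult_left_mono) auto
    moreover have "A powr (p - 1) * (c powr (p - 1) * H) = H powr p"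
      using pos by (simp add: c_def powr_divide powr_diff)
    ultimately show ?thesis by simp
  qed
  then show "(LINT x|M. a x * h x) powr p
           \<le> (LINT x|M. a x) powr (p - 1) * (LINT x|M. a x * h x powr p)"
    by (simp add: A_def H_def B_def)
qed

text \<open>Away from 0 the map y -> x/y is differentiable and its own inverse, so the exceptional t
  lie in the image of a null set under a differentiable map. For x = 0 only the value at 0 would be
  seen, and nothing could be concluded.\<close>

lemma AE_lebesgue_divide:
  assumes "AE y in lebesgue. P y" and "x \<noteq> (0::real)"
  shows "AE t in lebesgue. 0 < t \<longrightarrow> P (x / t)"
proof -
  obtain N where N: "N \<in> null_sets lebesgue" "{y. \<not> P y} \<subseteq> N"
    using assms(1) by (auto simp: eventually_ae_filter)
  have "negligible (N - {0})"
    using N by (auto simp: negligible_iff_null_sets[symmetric] intro: negligible_diff)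
  then have "negligible ((\<lambda>y. x / y) ` (N - {0}))"
    by (intro negligible_differentiable_image_negligible)
       (auto intro!: derivative_intros simp: differentiable_on_def)
  moreover have "{t. \<not> (0 < t \<longrightarrow> P (x / t))} \<subseteq> (\<lambda>y. x / y) ` (N - {0})"
  proof
    fix t assume t: "t \<in> {t. \<not> (0 < t \<longrightarrow> P (x / t))}"
    then have "x / t \<in> N - {0}" using N assms(2) by auto
    moreover have "t = x / (x / t)" using assms(2) by simp
    ultimately show "t \<in> (\<lambda>y. x / y) ` (N - {0})" by blast
  qed
  ultimately show ?thesis
    by (intro AE_I'[of "(\<lambda>y. x / y) ` (N - {0})"]) (auto simp: negligible_iff_null_sets)
qed

lemma Borel_version_complex:
  fixes f :: "real \<Rightarrow> complex"
  assumes [measurable]: "f \<in> borel_measurable lebesgue"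
  obtains g where "g \<in> borel_measurable borel" "AE x in lebesgue. f x = g x"
proof -
  obtain u where u: "u \<in> borel_measurable lborel" "AE x in lborel. Re (f x) = u x"
    using completion_ex_borel_measurable_real[of "\<lambda>x. Re (f x)" lborel] by auto
  obtain v where v: "v \<in> borel_measurable lborel" "AE x in lborel. Im (f x) = v x"
    using completion_ex_borel_measurable_real[of "\<lambda>x. Im (f x)" lborel] by auto
  note [measurable] = u(1) v(1)
  show ?thesis
  proof
    show "(\<lambda>x. Complex (u x) (v x)) \<in> borel_measurable borel"
      unfolding Complex_eq using u(1) v(1) by measurable
    have "AE x in lborel. f x = Complex (u x) (v x)"
      using u(2) v(2) by eventually_elim (simp add: complex_eq_iff)
    then show "AE x in lebesgue. f x = Complex (u x) (v x)"
      by (rule AE_completion)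
  qed
qed

text \<open>Under x = t y the Jacobian and the weight produce t^(1+\<alpha>), which the prefactor
  cancels. That prefactor is the p-th power of t^(-\<gamma>).\<close>

lemma nn_integral_power_weight_dilate:
  fixes g :: "real \<Rightarrow> real"
  assumes [measurable]: "g \<in> borel_measurable borel" and t: "0 < t"
    and g: "\<And>y. 0 \<le> g y"
  shows "(\<integral>\<^sup>+x. ennreal (t powr -(1 + \<alpha>) * g (x / t) * \<bar>x\<bar> powr \<alpha>) \<partial>lborel)
           = (\<integral>\<^sup>+y. ennreal (g y * \<bar>y\<bar> powr \<alpha>) \<partial>lborel)"
proof -
  have "(\<integral>\<^sup>+x. ennreal (t powr -(1 + \<alpha>) * g (x / t) * \<bar>x\<bar> powr \<alpha>) \<partial>lborel)
    = ennreal t * (\<integral>\<^sup>+y. ennreal (t powr -(1 + \<alpha>) * g y * \<bar>t * y\<bar> powr \<alpha>) \<partial>lborel)"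
    using t by (subst nn_integral_real_affine[where c = t and t = 0]) auto
  also have "\<dots> = (\<integral>\<^sup>+y. ennreal (t * (t powr -(1 + \<alpha>) * g y * \<bar>t * y\<bar> powr \<alpha>)) \<partial>lborel)"
    using t g by (subst nn_integral_cmult[symmetric]) (auto simp: ennreal_mult')
  also have "(\<lambda>y. t * (t powr -(1 + \<alpha>) * g y * \<bar>t * y\<bar> powr \<alpha>)) = (\<lambda>y. g y * \<bar>y\<bar> powr \<alpha>)"
  proof
    fix y
    have "t powr -(1 + \<alpha>) = inverse (t * t powr \<alpha>)"
      unfolding powr_minus powr_add using t by simp
    then show "t * (t powr -(1 + \<alpha>) * g y * \<bar>t * y\<bar> powr \<alpha>) = g y * \<bar>y\<bar> powr \<alpha>"
      using t by (simp add: abs_mult powr_mult field_simps)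
  qed
  finally show ?thesis .
qed

subsection \<open>The upper bound\<close>

text \<open>Here \<open>k\<close> is the norm of the integrand. Jensen in t for fixed x contributes
  \<open>A powr (p - 1)\<close>, and Tonelli with dilation contributes \<open>A * B\<close>. The
  outer integral is a nonnegative one, so its finiteness is a conclusion.\<close>

lemma hausdorff_Borel_bound:
  fixes \<psi> :: "real \<Rightarrow> real" and g :: "real \<Rightarrow> complex"
  assumes p: "1 < p"
    and [measurable]: "\<psi> \<in> borel_measurable borel" "g \<in> borel_measurable borel"
    and \<psi>: "\<And>t. 0 \<le> \<psi> t"
    and a_int: "integrable lborel (\<lambda>t. indicator {0<..} t * (t powr ((1 + \<alpha>) / p - 1) * \<psi> t))"
    and g: "integrable lborel (\<lambda>x. norm (g x) powr p * \<bar>x\<bar> powr \<alpha>)"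
  defines "k \<equiv> \<lambda>x t. indicator {0<..} t * (norm (g (x / t)) * (\<psi> t / t))"
  shows "AE x in lborel. integrable lborel (k x)"
    and "(\<integral>\<^sup>+x. ennreal ((LINT t|lborel. k x t) powr p * \<bar>x\<bar> powr \<alpha>) \<partial>lborel)
      \<le> ennreal ((LINT t|lborel. indicator {0<..} t * (t powr ((1 + \<alpha>) / p - 1) * \<psi> t)) powr p
          * (LINT x|lborel. norm (g x) powr p * \<bar>x\<bar> powr \<alpha>))"
proof -
  define a where "a = (\<lambda>t. indicator {0<..} t * (t powr ((1 + \<alpha>) / p - 1) * \<psi> t))"
  define h where "h = (\<lambda>x t. t powr -((1 + \<alpha>) / p) * norm (g (x / t)))"
  define F where "F = (\<lambda>x t. a t * h x t powr p)"
  define A where "A = (LINT t|lborel. a t)"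
  define B where "B = (LINT x|lborel. norm (g x) powr p * \<bar>x\<bar> powr \<alpha>)"
  have F_eq: "F x t = a t * h x t powr p" for x t
    by (simp add: F_def)
  have [measurable]: "a \<in> borel_measurable borel"
    by (simp add: a_def)
  have [measurable]: "(\<lambda>(x, t). h x t) \<in> borel_measurable (borel \<Otimes>\<^sub>M borel)"
    by (simp add: h_def)
  have [measurable]: "(\<lambda>(x, t). F x t) \<in> borel_measurable (borel \<Otimes>\<^sub>M borel)"
    unfolding F_def by measurable
  have a: "0 \<le> a t" "integrable lborel a" for t
    using \<psi> a_int by (auto simp: a_def)
  have h: "0 \<le> h x t" and F: "0 \<le> F x t" for x t
    using a by (auto simp: h_def F_def)
  have AB: "0 \<le> A" "0 \<le> B"
    using a by (auto simp: A_def B_def intro!: integral_nonneg_AE)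
  have k: "k x t = a t * h x t" for x t
    by (auto simp: k_def a_def h_def powr_minus powr_diff indicator_def)
  \<comment> \<open>Dilation invariance removes all dependence on t except the factor
    \<open>a t\<close>. For t \<le> 0 both sides vanish through the indicator in
    \<open>a\<close>.\<close>
  have inner: "(\<integral>\<^sup>+x. ennreal (F x t * \<bar>x\<bar> powr \<alpha>) \<partial>lborel) = ennreal (a t * B)" for t
  proof (cases "0 < t")
    case True
    have "F x t * \<bar>x\<bar> powr \<alpha>
        = a t * (t powr -(1 + \<alpha>) * norm (g (x / t)) powr p * \<bar>x\<bar> powr \<alpha>)" for x
    proof -
      have "(t powr -((1 + \<alpha>) / p)) powr p = t powr -(1 + \<alpha>)"
        unfolding powr_powr using p by (simp add: minus_divide_left)
      then show ?thesis
        by (simp add: F_def h_def powr_mult)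
    qed
    then have "(\<integral>\<^sup>+x. ennreal (F x t * \<bar>x\<bar> powr \<alpha>) \<partial>lborel)
        = (\<integral>\<^sup>+x. ennreal (a t) * ennreal (t powr -(1 + \<alpha>) * norm (g (x / t)) powr p * \<bar>x\<bar> powr \<alpha>) \<partial>lborel)"
      by (simp only: ennreal_mult'[OF a(1)])
    also have "\<dots> = ennreal (a t) * (\<integral>\<^sup>+y. ennreal (norm (g y) powr p * \<bar>y\<bar> powr \<alpha>) \<partial>lborel)"
      using nn_integral_power_weight_dilate[of "\<lambda>y. norm (g y) powr p" t \<alpha>] True
      by (subst nn_integral_cmult) auto
    also have "\<dots> = ennreal (a t * B)"
      using g by (subst nn_integral_eq_integral) (auto simp: B_def ennreal_mult'[OF a(1)])
    finally show ?thesis .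
  qed (auto simp: F_def a_def)
  have "(\<integral>\<^sup>+x. \<integral>\<^sup>+t. ennreal (F x t * \<bar>x\<bar> powr \<alpha>) \<partial>lborel \<partial>lborel)
      = (\<integral>\<^sup>+t. \<integral>\<^sup>+x. ennreal (F x t * \<bar>x\<bar> powr \<alpha>) \<partial>lborel \<partial>lborel)"
    by (rule lborel_pair.Fubini'[symmetric]) measurable
  also have "\<dots> = ennreal (A * B)"
    unfolding inner using a AB by (subst nn_integral_eq_integral) (auto simp: A_def)
  finally have total: "(\<integral>\<^sup>+x. \<integral>\<^sup>+t. ennreal (F x t * \<bar>x\<bar> powr \<alpha>) \<partial>lborel \<partial>lborel) = ennreal (A * B)" .
  have "AE x in lborel. (\<integral>\<^sup>+t. ennreal (F x t * \<bar>x\<bar> powr \<alpha>) \<partial>lborel) \<noteq> \<infinity>"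
    by (rule nn_integral_PInf_AE) (use total in auto)
  moreover have "AE x in lborel. x \<noteq> (0::real)"
    by (rule AE_lborel_singleton)
  \<comment> \<open>The finite double integral makes almost every inner one finite; x \<noteq> 0
    allows the nonzero constant |x|^\<alpha> to be divided out.\<close>
  ultimately have ae: "AE x in lborel. x \<noteq> 0 \<and> integrable lborel (F x)"
  proof eventually_elim
    case (elim x)
    have "integrable lborel (\<lambda>t. F x t * \<bar>x\<bar> powr \<alpha>)"
      using elim F by (intro integrableI_nonneg) (auto simp: top.not_eq_extremum)
    then show ?case using elim by simp
  qed
  note Jensen = weighted_Jensen_powr[OF p _ a(2,1), of "h x" for x, folded k F_eq]
  show "AE x in lborel. integrable lborel (k x)"
    using ae by eventually_elim (auto intro!: Jensen(1) h)
  have "AE x in lborel. ennreal ((LINT t|lborel. k x t) powr p * \<bar>x\<bar> powr \<alpha>)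
      \<le> ennreal (A powr (p - 1)) * (\<integral>\<^sup>+t. ennreal (F x t * \<bar>x\<bar> powr \<alpha>) \<partial>lborel)"
    using ae
  proof eventually_elim
    case (elim x)
    have "(LINT t|lborel. k x t) powr p \<le> A powr (p - 1) * (LINT t|lborel. F x t)"
      unfolding A_def by (rule Jensen(2)) (use elim h in auto)
    then have "(LINT t|lborel. k x t) powr p * \<bar>x\<bar> powr \<alpha>
        \<le> A powr (p - 1) * (LINT t|lborel. F x t) * \<bar>x\<bar> powr \<alpha>"
      by (intro mult_right_mono) auto
    also have "\<dots> = A powr (p - 1) * (LINT t|lborel. F x t * \<bar>x\<bar> powr \<alpha>)"
      by simp
    finally show ?case
      using elim F
      by (subst nn_integral_eq_integral) (auto simp: ennreal_mult'[symmetric] intro!: ennreal_leI)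
  qed
  then have "(\<integral>\<^sup>+x. ennreal ((LINT t|lborel. k x t) powr p * \<bar>x\<bar> powr \<alpha>) \<partial>lborel)
      \<le> (\<integral>\<^sup>+x. ennreal (A powr (p - 1)) * (\<integral>\<^sup>+t. ennreal (F x t * \<bar>x\<bar> powr \<alpha>) \<partial>lborel) \<partial>lborel)"
    by (rule nn_integral_mono_AE)
  also have "\<dots> = ennreal (A powr (p - 1)) * ennreal (A * B)"
    by (subst nn_integral_cmult) (auto simp: total)
  also have "\<dots> = ennreal (A powr p * B)"
    using AB powr_mult_base[of A "p - 1"] by (simp add: ennreal_mult'[symmetric] mult_ac)
  finally show "(\<integral>\<^sup>+x. ennreal ((LINT t|lborel. k x t) powr p * \<bar>x\<bar> powr \<alpha>) \<partial>lborel)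
      \<le> ennreal ((LINT t|lborel. indicator {0<..} t * (t powr ((1 + \<alpha>) / p - 1) * \<psi> t)) powr p
          * (LINT x|lborel. norm (g x) powr p * \<bar>x\<bar> powr \<alpha>))"
    by (simp add: A_def B_def a_def)
qed

section \<open>The weighted space in terms of Lebesgue measure\<close>

lemma abs_powr_lebesgue_measurable [measurable]:
  "(\<lambda>x::real. \<bar>x\<bar> powr \<alpha>) \<in> borel_measurable lebesgue"
  by (rule measurable_completion) measurable

text \<open>The density vanishes only at 0, so the two measures have the same null sets.\<close>

lemma AE_power_weight_iff:
  "(AE x in power_weight \<alpha>. P x) \<longleftrightarrow> (AE x in lebesgue. P x)"
proof
  have "AE x in lebesgue. x \<noteq> (0::real)"
    by (intro AE_completion AE_lborel_singleton)
  moreover assume "AE x in power_weight \<alpha>. P x"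
  then have "AE x in lebesgue. 0 < ennreal (\<bar>x\<bar> powr \<alpha>) \<longrightarrow> P x"
    unfolding power_weight_def by (subst (asm) AE_density) auto
  ultimately show "AE x in lebesgue. P x"
    by eventually_elim auto
next
  assume "AE x in lebesgue. P x"
  then show "AE x in power_weight \<alpha>. P x"
    unfolding power_weight_def by (subst AE_density) auto
qed

lemma Lp_space_power_weight_iff:
  "f \<in> Lp_space p (power_weight \<alpha>) \<longleftrightarrow> f \<in> borel_measurable lebesgue \<and>
     integrable lebesgue (\<lambda>x. norm (f x) powr p * \<bar>x\<bar> powr \<alpha>)"
proof -
  have "integrable (power_weight \<alpha>) (\<lambda>x. norm (f x) powr p) \<longleftrightarrow>
      integrable lebesgue (\<lambda>x. norm (f x) powr p * \<bar>x\<bar> powr \<alpha>)"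
    if [measurable]: "f \<in> borel_measurable lebesgue"
    unfolding power_weight_def by (subst integrable_density) (auto simp: mult.commute)
  then show ?thesis
    by (auto simp: Lp_space_def power_weight_def)
qed

lemma Lp_norm_power_weight:
  assumes [measurable]: "f \<in> borel_measurable lebesgue"
  shows "Lp_norm p (power_weight \<alpha>) f
           = (LINT x|lebesgue. norm (f x) powr p * \<bar>x\<bar> powr \<alpha>) powr (1 / p)"
  unfolding Lp_norm_def power_weight_def
  by (subst integral_density) (auto simp: mult.commute)

section \<open>From Borel to Lebesgue measurable kernels and functions\<close>

locale hausdorff_kernel =
  fixes p \<alpha> :: real and \<phi> :: "real \<Rightarrow> real"
  assumes p: "1 < p" and \<phi>_meas: "\<phi> \<in> borel_measurable (lebesgue_on {0<..})"
    and \<phi>_nonneg: "\<And>t. t > 0 \<Longrightarrow> \<phi> t \<ge> 0"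
    and \<phi>_int: "set_integrable lebesgue {0<..} (\<lambda>t. t powr ((1 + \<alpha>) / p - 1) * \<phi> t)"
begin

text \<open>The constant A of the overview, which will be the operator norm.\<close>

definition mass :: real where
  "mass = (LINT t:{0<..}|lebesgue. t powr ((1 + \<alpha>) / p - 1) * \<phi> t)"

lemma mass_nonneg: "0 \<le> mass"
  unfolding mass_def set_lebesgue_integral_def
  using \<phi>_nonneg by (intro integral_nonneg_AE) (auto simp: indicator_def)

lemma Borel_kernel:
  obtains \<psi> where "\<psi> \<in> borel_measurable borel" "\<And>t. 0 \<le> \<psi> t"
    "AE t in lebesgue. 0 < t \<longrightarrow> \<phi> t = \<psi> t"
    "integrable lborel (\<lambda>t. indicator {0<..} t * (t powr ((1 + \<alpha>) / p - 1) * \<psi> t))"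
    "(LINT t|lborel. indicator {0<..} t * (t powr ((1 + \<alpha>) / p - 1) * \<psi> t)) = mass"
proof -
  have "(\<lambda>t. if t \<in> {0<..} then \<phi> t else 0) \<in> borel_measurable lebesgue"
    by (rule borel_measurable_if_I[OF \<phi>_meas]) auto
  then obtain u where u: "u \<in> borel_measurable lborel"
      "AE t in lborel. (if t \<in> {0<..} then \<phi> t else 0) = u t"
    using completion_ex_borel_measurable_real by blast
  \<comment> \<open>The weight in Jensen's inequality must be nonnegative at every point. Truncating
    at 0 achieves this and keeps the almost everywhere equality, since \<phi> is nonnegative on the
    half-line.\<close>
  define \<psi> where "\<psi> = (\<lambda>t. max 0 (u t))"
  have [measurable]: "\<psi> \<in> borel_measurable borel"
    using u(1) by (simp add: \<psi>_def)
  have ae: "AE t in lebesgue. 0 < t \<longrightarrow> \<phi> t = \<psi> t"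
    using AE_completion[OF u(2)]
    by eventually_elim (auto simp: \<psi>_def max_def not_le dest: \<phi>_nonneg split: if_splits)
  let ?b = "\<lambda>t. indicator {0<..} t * (t powr ((1 + \<alpha>) / p - 1) * \<psi> t)"
  let ?a = "\<lambda>t. indicator {0<..} t *\<^sub>R (t powr ((1 + \<alpha>) / p - 1) * \<phi> t)"
  have b: "?b \<in> borel_measurable lborel"
    by measurable
  have eq: "AE t in lebesgue. ?a t = ?b t"
    using ae by eventually_elim (auto simp: indicator_def)
  have a: "integrable lebesgue ?a"
    using \<phi>_int by (simp add: set_integrable_def)
  then have "integrable lebesgue ?b"
    using eq measurable_completion[OF b] by (subst integrable_cong_AE[where g = ?a]) auto
  moreover have "mass = integral\<^sup>L lebesgue ?b"
    unfolding mass_def set_lebesgue_integral_def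
    using eq a measurable_completion[OF b] by (intro integral_cong_AE) auto
  moreover have "0 \<le> \<psi> t" for t
    by (simp add: \<psi>_def)
  ultimately show ?thesis
    using ae b by (intro that[of \<psi>]) (auto simp: integrable_completion integral_completion)
qed

text \<open>For each x \<noteq> 0 the integrands built from (\<phi>, f) and from their Borel
  versions agree for almost every t, so existence, value and bound of the integral carry over from
  the Borel case.\<close>

lemma Lp_bound:
  assumes f: "f \<in> Lp_space p (power_weight \<alpha>)"
  shows "AE x in lebesgue. set_integrable lebesgue {0<..} (hausdorff_integrand \<phi> f x)"
    and "hausdorff_op \<phi> f \<in> Lp_space p (power_weight \<alpha>)"
    and "Lp_norm p (power_weight \<alpha>) (hausdorff_op \<phi> f) \<le> mass * Lp_norm p (power_weight \<alpha>) f"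
proof -
  have f_meas: "f \<in> borel_measurable lebesgue"
    and f_int: "integrable lebesgue (\<lambda>x. norm (f x) powr p * \<bar>x\<bar> powr \<alpha>)"
    using f by (auto simp: Lp_space_power_weight_iff)
  obtain g where [measurable]: "g \<in> borel_measurable borel" and fg: "AE x in lebesgue. f x = g x"
    using Borel_version_complex[OF f_meas] .
  obtain \<psi> where [measurable]: "\<psi> \<in> borel_measurable borel" and \<psi>: "\<And>t. 0 \<le> \<psi> t"
      "AE t in lebesgue. 0 < t \<longrightarrow> \<phi> t = \<psi> t"
    and \<psi>_int: "integrable lborel (\<lambda>t. indicator {0<..} t * (t powr ((1 + \<alpha>) / p - 1) * \<psi> t))"
    and \<psi>_mass: "(LINT t|lborel. indicator {0<..} t * (t powr ((1 + \<alpha>) / p - 1) * \<psi> t)) = mass"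
    using Borel_kernel by blast
  define B where "B = (LINT x|lebesgue. norm (f x) powr p * \<bar>x\<bar> powr \<alpha>)"
  have B: "0 \<le> B"
    by (auto simp: B_def intro!: integral_nonneg_AE)
  have Bg_meas: "(\<lambda>x. norm (g x) powr p * \<bar>x\<bar> powr \<alpha>) \<in> borel_measurable lborel"
    by measurable
  have Bg_eq: "AE x in lebesgue. norm (g x) powr p * \<bar>x\<bar> powr \<alpha> = norm (f x) powr p * \<bar>x\<bar> powr \<alpha>"
    using fg by eventually_elim simp
  have "integrable lebesgue (\<lambda>x. norm (g x) powr p * \<bar>x\<bar> powr \<alpha>)"
    using measurable_completion[OF Bg_meas] f_int Bg_eq
    by (subst integrable_cong_AE[OF _ _ Bg_eq]) auto
  then have g_int: "integrable lborel (\<lambda>x. norm (g x) powr p * \<bar>x\<bar> powr \<alpha>)"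
    using Bg_meas by (simp add: integrable_completion)
  have "B = (LINT x|lebesgue. norm (g x) powr p * \<bar>x\<bar> powr \<alpha>)"
    unfolding B_def using measurable_completion[OF Bg_meas] f_int Bg_eq
    by (intro integral_cong_AE) auto
  then have g_B: "(LINT x|lborel. norm (g x) powr p * \<bar>x\<bar> powr \<alpha>) = B"
    using Bg_meas by (simp add: integral_completion)

  \<comment> \<open>\<open>I\<close> is the given integrand, \<open>J\<close> its Borel counterpart
    and \<open>k\<close> the norm of \<open>J\<close>.\<close>
  define I where "I = (\<lambda>x t. indicator {0<..} t *\<^sub>R hausdorff_integrand \<phi> f x t)"
  define J where "J = (\<lambda>x t. indicator {0<..} t *\<^sub>R hausdorff_integrand \<psi> g x t)"
  define k where "k = (\<lambda>x t. indicator {0<..} t * (norm (g (x / t)) * (\<psi> t / t)))"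
  have norm_J: "norm (J x t) = k x t" for x t
    using \<psi>(1)[of t] by (auto simp: J_def k_def hausdorff_integrand_def indicator_def norm_mult norm_divide)
  have J_meas[measurable]: "(\<lambda>(x, t). J x t) \<in> borel_measurable (borel \<Otimes>\<^sub>M borel)"
    unfolding J_def hausdorff_integrand_def by measurable
  have JI: "AE t in lebesgue. J x t = I x t" if "x \<noteq> 0" for x
    using AE_lebesgue_divide[OF fg that] \<psi>(2)
    by eventually_elim (auto simp: I_def J_def hausdorff_integrand_def indicator_def)
  have J_meas_leb: "J x \<in> borel_measurable lebesgue" for x
    by (rule measurable_completion) simp
  \<comment> \<open>Composing a Lebesgue measurable f with t -> x/t is not obviously measurable;
    measurability is inherited from \<open>J x\<close> by completeness of the measure.\<close>
  have I_meas: "I x \<in> borel_measurable lebesgue" if "x \<noteq> 0" for x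
    using borel_measurable_AE[OF J_meas_leb JI[OF that]] .
  have I_int: "integrable lebesgue (I x) \<longleftrightarrow> integrable lborel (k x)" if "x \<noteq> 0" for x
  proof -
    have "integrable lebesgue (I x) \<longleftrightarrow> integrable lebesgue (J x)"
      using JI[OF that] I_meas[OF that] J_meas_leb
      by (intro integrable_cong_AE) (auto simp: eq_commute)
    also have "\<dots> \<longleftrightarrow> integrable lborel (J x)"
      by (simp add: integrable_completion)
    also have "\<dots> \<longleftrightarrow> integrable lborel (k x)"
      unfolding norm_J[symmetric] by (subst integrable_norm_iff) auto
    finally show ?thesis .
  qed
  have T_eq: "hausdorff_op \<phi> f x = (LINT t|lborel. J x t)" if "x \<noteq> 0" for x
  proof -
    have "hausdorff_op \<phi> f x = integral\<^sup>L lebesgue (I x)"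
      by (simp add: hausdorff_op_def set_lebesgue_integral_def I_def)
    also have "\<dots> = integral\<^sup>L lebesgue (J x)"
      using JI[OF that] I_meas[OF that] J_meas_leb
      by (intro integral_cong_AE) (auto simp: eq_commute)
    also have "\<dots> = integral\<^sup>L lborel (J x)"
      by (simp add: integral_completion)
    finally show ?thesis .
  qed
  note bound = hausdorff_Borel_bound[OF p \<open>\<psi> \<in> _\<close> \<open>g \<in> _\<close> \<psi>(1) \<psi>_int g_int,
      folded k_def, unfolded \<psi>_mass g_B]
  have nz: "AE x in lebesgue. x \<noteq> (0::real)"
    by (intro AE_completion AE_lborel_singleton)
  have k_ae: "AE x in lebesgue. integrable lborel (k x)"
    using bound(1) by (intro AE_completion) (simp add: k_def)
  show "AE x in lebesgue. set_integrable lebesgue {0<..} (hausdorff_integrand \<phi> f x)"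
    using k_ae nz by eventually_elim (simp add: set_integrable_def I_int[unfolded I_def])
  have "(\<lambda>x. LINT t|lborel. J x t) \<in> borel_measurable lborel"
    by measurable
  from measurable_completion[OF this] have T_meas: "hausdorff_op \<phi> f \<in> borel_measurable lebesgue"
    by (rule borel_measurable_AE) (use nz in eventually_elim, simp add: T_eq)
  have "(\<integral>\<^sup>+x. ennreal (norm (hausdorff_op \<phi> f x) powr p * \<bar>x\<bar> powr \<alpha>) \<partial>lebesgue)
      \<le> (\<integral>\<^sup>+x. ennreal ((LINT t|lborel. k x t) powr p * \<bar>x\<bar> powr \<alpha>) \<partial>lebesgue)"
  proof (rule nn_integral_mono_AE, use nz in eventually_elim)
    fix x :: real assume x: "x \<noteq> 0"
    have "norm (hausdorff_op \<phi> f x) \<le> (LINT t|lborel. k x t)"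
      unfolding T_eq[OF x] norm_J[symmetric] by (rule integral_norm_bound)
    then show "ennreal (norm (hausdorff_op \<phi> f x) powr p * \<bar>x\<bar> powr \<alpha>)
        \<le> ennreal ((LINT t|lborel. k x t) powr p * \<bar>x\<bar> powr \<alpha>)"
      using p by (intro ennreal_leI mult_right_mono powr_mono2) auto
  qed
  also have "\<dots> \<le> ennreal (mass powr p * B)"
    using bound(2) by (simp add: nn_integral_completion k_def)
  finally have le: "(\<integral>\<^sup>+x. ennreal (norm (hausdorff_op \<phi> f x) powr p * \<bar>x\<bar> powr \<alpha>) \<partial>lebesgue)
      \<le> ennreal (mass powr p * B)" .
  then have T_int: "integrable lebesgue (\<lambda>x. norm (hausdorff_op \<phi> f x) powr p * \<bar>x\<bar> powr \<alpha>)"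
    using T_meas by (intro integrableI_nonneg) (auto intro: le_less_trans)
  with T_meas show "hausdorff_op \<phi> f \<in> Lp_space p (power_weight \<alpha>)"
    by (simp add: Lp_space_power_weight_iff)
  have "(LINT x|lebesgue. norm (hausdorff_op \<phi> f x) powr p * \<bar>x\<bar> powr \<alpha>) \<le> mass powr p * B"
    using le T_int B by (simp add: nn_integral_eq_integral)
  then have "(LINT x|lebesgue. norm (hausdorff_op \<phi> f x) powr p * \<bar>x\<bar> powr \<alpha>) powr (1 / p)
      \<le> (mass powr p * B) powr (1 / p)"
    using p by (intro powr_mono2) (auto intro!: integral_nonneg_AE)
  also have "\<dots> = mass * B powr (1 / p)"
    using p mass_nonneg B by (simp add: powr_mult powr_powr)
  finally show "Lp_norm p (power_weight \<alpha>) (hausdorff_op \<phi> f) \<le> mass * Lp_norm p (power_weight \<alpha>) f"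
    using T_meas f_meas by (simp add: Lp_norm_power_weight B_def)
qed

end

subsection \<open>Test functions and the lower bound\<close>

lemma has_bochner_integral_inverse_Icc:
  fixes a b :: real
  assumes "0 < a" "a \<le> b"
  shows "has_bochner_integral lebesgue (\<lambda>x. indicator {a..b} x * inverse x) (ln b - ln a)"
proof -
  have "has_bochner_integral lborel (\<lambda>x. inverse x * indicator {a..b} x) (ln b - ln a)"
    using assms by (intro has_bochner_integral_FTC_Icc_nonneg) (auto intro!: derivative_eq_intros simp: inverse_eq_divide)
  then show ?thesis
    by (simp add: has_bochner_integral_iff integrable_completion integral_completion mult.commute)
qed

context hausdorff_kernel
begin

definition mass_trunc :: "real \<Rightarrow> real" where
  "mass_trunc N = (LINT t:{inverse N..N}|lebesgue. t powr ((1 + \<alpha>) / p - 1) * \<phi> t)"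

text \<open>On the positive half-line x^(-\<gamma>) is formally an eigenfunction with eigenvalue
  \<open>mass\<close>. Its p-th power times the weight is 1/x, so it misses the space only
  logarithmically; the cutoff puts it inside.\<close>

definition test_fun :: "real \<Rightarrow> real \<Rightarrow> complex" where
  "test_fun R x = complex_of_real (indicator {1..R} x * x powr -((1 + \<alpha>) / p))"

lemma powr_critical:
  assumes "0 < x"
  shows "(x powr -((1 + \<alpha>) / p)) powr p * \<bar>x\<bar> powr \<alpha> = inverse x"
proof -
  have "(x powr -((1 + \<alpha>) / p)) powr p = x powr -(1 + \<alpha>)"
    unfolding powr_powr using p by (simp add: minus_divide_left)
  moreover have "x powr -(1 + \<alpha>) * x powr \<alpha> = x powr -1"
    by (simp only: powr_add[symmetric]) simp
  ultimately show ?thesis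
    using assms by (simp add: powr_minus)
qed

lemma test_fun_norm:
  "norm (test_fun R x) powr p * \<bar>x\<bar> powr \<alpha> = indicator {1..R} x * inverse x"
  using powr_critical[of x] p by (auto simp: test_fun_def indicator_def)

lemma test_fun_measurable: "test_fun R \<in> borel_measurable lebesgue"
  unfolding test_fun_def by (rule measurable_completion) measurable

lemma test_fun_Lp:
  assumes "1 \<le> R"
  shows "test_fun R \<in> Lp_space p (power_weight \<alpha>)"
    and "Lp_norm p (power_weight \<alpha>) (test_fun R) = ln R powr (1 / p)"
  using has_bochner_integral_inverse_Icc[of 1 R] assms
  by (simp_all add: Lp_space_power_weight_iff Lp_norm_power_weight test_fun_measurable
      test_fun_norm has_bochner_integral_iff)

lemma mass_trunc_nonneg: "0 < N \<Longrightarrow> 0 \<le> mass_trunc N"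
  unfolding mass_trunc_def set_lebesgue_integral_def
proof (rule integral_nonneg_AE, rule AE_I2)
  fix t assume "0 < N"
  then have "0 < t" if "t \<in> {inverse N..N}"
    using that by (auto elim: less_le_trans[rotated])
  then show "0 \<le> indicator {inverse N..N} t *\<^sub>R (t powr ((1 + \<alpha>) / p - 1) * \<phi> t)"
    using \<phi>_nonneg[of t] by (auto simp: indicator_def)
qed

text \<open>The cutoff 1 \<le> x/t \<le> R means that t lies in \<open>{x / R..x}\<close>. For N
  \<le> x \<le> R/N this interval contains [1/N, N], which gives a bound with a constant independent
  of x.\<close>

lemma hausdorff_op_test_fun_ge:
  assumes N: "0 < N" "N \<le> x" "x \<le> R / N"
  shows "x powr -((1 + \<alpha>) / p) * mass_trunc N \<le> norm (hausdorff_op \<phi> (test_fun R) x)"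
proof -
  let ?\<gamma> = "(1 + \<alpha>) / p"
  let ?a = "\<lambda>t. t powr (?\<gamma> - 1) * \<phi> t"
  have x: "0 < x"
    using N by linarith
  then have "0 < N * x" "N * x \<le> R"
    using N by (simp_all add: field_simps)
  then have R: "0 < R"
    by linarith
  have sub: "{inverse N..N} \<subseteq> {x / R..x}"
  proof -
    have "x / R \<le> inverse N"
      using N R by (simp add: field_simps)
    then show ?thesis using N by auto
  qed
  have pos: "{x / R..x} \<subseteq> {0<..}"
    using x R by (auto intro: less_le_trans[rotated])
  have int: "set_integrable lebesgue S ?a" if "S \<subseteq> {x / R..x}" "S \<in> sets lebesgue" for S
    by (rule set_integrable_subset[OF \<phi>_int]) (use that pos in auto)
  \<comment> \<open>The homogeneity of x^(-\<gamma>) separates x from t, leaving the weight of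
    \<open>mass\<close> on the interval where the cutoff is 1.\<close>
  have "indicator {0<..} t *\<^sub>R hausdorff_integrand \<phi> (test_fun R) x t
      = complex_of_real (x powr -?\<gamma> * (indicator {x / R..x} t *\<^sub>R ?a t))" for t
  proof (cases "0 < t")
    case True
    have "indicator {1..R} (x / t) = (indicator {x / R..x} t :: real)"
      using True R x by (auto simp: indicator_def field_simps)
    moreover have "(x / t) powr -?\<gamma> * (\<phi> t / t) = x powr -?\<gamma> * ?a t"
    proof -
      have "(x / t) powr -?\<gamma> = x powr -?\<gamma> * t powr ?\<gamma>"
        using True x by (simp add: powr_divide powr_minus field_simps)
      then show ?thesis
        using True by (simp add: powr_diff)
    qed
    ultimately have "indicator {1..R} (x / t) * (x / t) powr -?\<gamma> * (\<phi> t / t)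
        = x powr -?\<gamma> * (indicator {x / R..x} t *\<^sub>R ?a t)"
      by (simp only: mult.assoc real_scaleR_def mult.left_commute)
    then show ?thesis
      using True
      by (simp only: hausdorff_integrand_def test_fun_def of_real_mult[symmetric]) simp
  next
    case False
    then have "t \<notin> {x / R..x}" using pos by auto
    with False show ?thesis by simp
  qed
  then have "hausdorff_op \<phi> (test_fun R) x
      = complex_of_real (x powr -?\<gamma> * (LINT t:{x / R..x}|lebesgue. ?a t))"
    unfolding hausdorff_op_def set_lebesgue_integral_def
    by (simp only: integral_complex_of_real integral_mult_right_zero)
  moreover have "mass_trunc N \<le> (LINT t:{x / R..x}|lebesgue. ?a t)"
    unfolding mass_trunc_def set_lebesgue_integral_def
  proof (rule integral_mono)
    show "integrable lebesgue (\<lambda>t. indicator {inverse N..N} t *\<^sub>R ?a t)"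
      using int[OF sub] by (simp add: set_integrable_def)
    show "integrable lebesgue (\<lambda>t. indicator {x / R..x} t *\<^sub>R ?a t)"
      using int[OF order_refl] by (simp add: set_integrable_def)
    show "indicator {inverse N..N} t *\<^sub>R ?a t \<le> indicator {x / R..x} t *\<^sub>R ?a t" for t
      using sub pos \<phi>_nonneg[of t] by (auto simp: indicator_def)
  qed
  ultimately show ?thesis
    by (auto intro!: mult_left_mono order_trans[OF _ abs_ge_self] simp: norm_mult)
qed

text \<open>The norm of the image is bounded below by its part over [N, R/N], where the integrand is
  at least \<open>mass_trunc N powr p\<close> times 1/x. Of the logarithmic length ln R, the
  restriction to this interval loses 2 ln N.\<close>

lemma test_fun_ratio:
  assumes N: "1 \<le> N" and R: "N \<le> R / N" "1 < R"
  shows "mass_trunc N * (1 - 2 * ln N / ln R) powr (1 / p)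
     \<le> Lp_norm p (power_weight \<alpha>) (hausdorff_op \<phi> (test_fun R))
        / Lp_norm p (power_weight \<alpha>) (test_fun R)"
proof -
  let ?T = "hausdorff_op \<phi> (test_fun R)"
  \<comment> \<open>This keeps ln R - 2 ln N nonnegative, as needed for taking the p-th root factor
    by factor.\<close>
  have "N * N \<le> R" using N R by (simp add: field_simps)
  then have "ln (N * N) \<le> ln R" using N R by (subst ln_le_cancel_iff) auto
  then have ln: "2 * ln N \<le> ln R" "0 < ln R" using N R by (auto simp: ln_mult)
  have mass: "0 \<le> mass_trunc N" using N by (intro mass_trunc_nonneg) auto
  have T: "?T \<in> Lp_space p (power_weight \<alpha>)"
    using R by (intro Lp_bound(2) test_fun_Lp(1)) auto
  have inv: "has_bochner_integral lebesgue (\<lambda>x. indicator {N..R / N} x * inverse x) (ln R - 2 * ln N)"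
    using has_bochner_integral_inverse_Icc[of N "R / N"] N R by (simp add: ln_div)
  have "(LINT x|lebesgue. mass_trunc N powr p * (indicator {N..R / N} x * inverse x))
      \<le> (LINT x|lebesgue. norm (?T x) powr p * \<bar>x\<bar> powr \<alpha>)"
  proof (rule integral_mono)
    show "integrable lebesgue (\<lambda>x. mass_trunc N powr p * (indicator {N..R / N} x * inverse x))"
      using inv by (intro integrable_mult_right) (simp add: has_bochner_integral_iff)
    show "integrable lebesgue (\<lambda>x. norm (?T x) powr p * \<bar>x\<bar> powr \<alpha>)"
      using T by (simp add: Lp_space_power_weight_iff)
    fix x
    show "mass_trunc N powr p * (indicator {N..R / N} x * inverse x) \<le> norm (?T x) powr p * \<bar>x\<bar> powr \<alpha>"
    proof (cases "x \<in> {N..R / N}")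
      case True
      then have x: "0 < x" using N by auto
      have "mass_trunc N powr p * inverse x = (x powr -((1 + \<alpha>) / p) * mass_trunc N) powr p * \<bar>x\<bar> powr \<alpha>"
        using mass powr_critical[OF x] by (simp add: powr_mult mult_ac)
      also have "\<dots> \<le> norm (?T x) powr p * \<bar>x\<bar> powr \<alpha>"
        using hausdorff_op_test_fun_ge[of N x R] N True mass p
        by (intro mult_right_mono powr_mono2) auto
      finally show ?thesis using True by simp
    qed simp
  qed
  then have "mass_trunc N powr p * (ln R - 2 * ln N)
      \<le> (LINT x|lebesgue. norm (?T x) powr p * \<bar>x\<bar> powr \<alpha>)"
    using inv by (simp add: has_bochner_integral_iff)
  then have "(mass_trunc N powr p * (ln R - 2 * ln N)) powr (1 / p) \<le> Lp_norm p (power_weight \<alpha>) ?T"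
    using T p ln by (auto simp: Lp_norm_power_weight Lp_space_power_weight_iff intro!: powr_mono2)
  moreover have "(mass_trunc N powr p * (ln R - 2 * ln N)) powr (1 / p)
      = mass_trunc N * (1 - 2 * ln N / ln R) powr (1 / p) * ln R powr (1 / p)"
  proof -
    have "ln R - 2 * ln N = (1 - 2 * ln N / ln R) * ln R"
      using ln by (simp add: field_simps)
    moreover have "0 \<le> 1 - 2 * ln N / ln R"
      using ln by simp
    ultimately show ?thesis
      using mass p ln by (simp only: powr_mult powr_powr) (simp add: powr_mult powr_powr)
  qed
  ultimately show ?thesis
    using R ln by (simp add: test_fun_Lp(2) pos_le_divide_eq)
qed

section \<open>The limit, the operator norm and boundedness\<close>

lemma mass_trunc_tendsto: "(\<lambda>n. mass_trunc (exp (real n))) \<longlonglongrightarrow> mass"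
proof -
  \<comment> \<open>The intervals increase to the half-line, so the integrals converge by continuity
    from below.\<close>
  have U: "(\<Union>n. {inverse (exp (real n))..exp (real n)}) = {0<..}"
  proof (intro equalityI subsetI)
    fix t :: real assume t: "t \<in> {0<..}"
    obtain n where "\<bar>ln t\<bar> \<le> real n"
      using real_arch_simple by blast
    then have "exp (- real n) \<le> exp (ln t)" "exp (ln t) \<le> exp (real n)"
      unfolding exp_le_cancel_iff by linarith+
    with t show "t \<in> (\<Union>n. {inverse (exp (real n))..exp (real n)})"
      by (auto simp: exp_minus)
  qed (auto intro: less_le_trans[rotated])
  have "(\<lambda>n. mass_trunc (exp (real n)))
      \<longlonglongrightarrow> (LINT t:(\<Union>n. {inverse (exp (real n))..exp (real n)})|lebesgue. t powr ((1 + \<alpha>) / p - 1) * \<phi> t)"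
    unfolding mass_trunc_def
  proof (rule set_integral_cont_up)
    show "set_integrable lebesgue (\<Union>n. {inverse (exp (real n))..exp (real n)}) (\<lambda>t. t powr ((1 + \<alpha>) / p - 1) * \<phi> t)"
      unfolding U by (rule \<phi>_int)
  qed (auto simp: incseq_def exp_minus[symmetric])
  then show ?thesis
    by (simp add: U mass_def)
qed

lemma Lp_onorm_eq: "Lp_onorm p (power_weight \<alpha>) (hausdorff_op \<phi>) = mass"
proof (rule antisym)
  let ?W = "power_weight \<alpha>"
  let ?r = "\<lambda>f. Lp_norm p ?W (hausdorff_op \<phi> f) / Lp_norm p ?W f"
  have upper: "?r f \<le> mass" if "f \<in> Lp_space p ?W" for f
  \<comment> \<open>When the norm is zero, division by zero makes the ratio 0, which
    \<open>mass\<close> dominates by nonnegativity.\<close>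
  proof (cases "Lp_norm p ?W f = 0")
    case False
    then have "0 < Lp_norm p ?W f"
      by (auto simp: Lp_norm_def)
    then show ?thesis
      using Lp_bound(3)[OF that] by (simp add: pos_divide_le_eq)
  qed (simp add: mass_nonneg)
  have "Lp_space p ?W \<noteq> {}"
    using test_fun_Lp(1)[of 1] by auto
  then show "Lp_onorm p ?W (hausdorff_op \<phi>) \<le> mass"
    unfolding Lp_onorm_def using upper by (intro cSUP_least)
  \<comment> \<open>With N = e^n and ln R = n^2 the relative loss 2 ln N / ln R is 2/n. The
    condition 2 \<le> n ensures N \<le> R/N.\<close>
  have lower: "mass_trunc (exp (real n)) * (1 - 2 / real n) powr (1 / p) \<le> Lp_onorm p ?W (hausdorff_op \<phi>)"
    if n: "2 \<le> n" for n
  proof -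
    let ?f = "test_fun (exp (real n ^ 2))"
    have "mass_trunc (exp (real n)) * (1 - 2 * ln (exp (real n)) / ln (exp (real n ^ 2))) powr (1 / p) \<le> ?r ?f"
    proof (rule test_fun_ratio)
      have "real n + real n \<le> real n ^ 2"
        using n by (simp add: power2_eq_square)
      then show "exp (real n) \<le> exp (real n ^ 2) / exp (real n)"
        by (simp add: exp_diff[symmetric])
    qed (use n in auto)
    also have "?r ?f \<le> Lp_onorm p ?W (hausdorff_op \<phi>)"
      \<comment> \<open>A real supremum dominates its members only if the set is bounded above; the
        upper bound supplies this.\<close>
      unfolding Lp_onorm_def using upper
      by (intro cSUP_upper test_fun_Lp(1)) (auto intro!: bdd_aboveI2)
    finally show ?thesis
      using n by (simp add: power2_eq_square)
  qed
  have "(\<lambda>n. 1 - 2 / real n) \<longlonglongrightarrow> 1 - 0"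
    by (intro tendsto_intros lim_const_over_n)
  then have "(\<lambda>n. mass_trunc (exp (real n)) * (1 - 2 / real n) powr (1 / p)) \<longlonglongrightarrow> mass * 1 powr (1 / p)"
    by (intro tendsto_mult mass_trunc_tendsto tendsto_powr tendsto_const) auto
  then show "mass \<le> Lp_onorm p ?W (hausdorff_op \<phi>)"
    using lower by (intro LIMSEQ_le_const2[of _ "mass"]) (auto intro!: exI[of _ 2])
qed

text \<open>Homogeneity holds at every x, even where the integral takes its default value 0.
  Additivity is shown where both integrals exist, which \<open>Lp_bound\<close> guarantees almost
  everywhere.\<close>

lemma bounded: "bounded_on_Lp p (power_weight \<alpha>) (hausdorff_op \<phi>)"
  unfolding bounded_on_Lp_def AE_power_weight_iff
proof (intro conjI ballI allI impI)
  have nz: "AE x in lebesgue. x \<noteq> (0::real)"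
    by (intro AE_completion AE_lborel_singleton)
  fix f assume f: "f \<in> Lp_space p (power_weight \<alpha>)"
  show "hausdorff_op \<phi> f \<in> Lp_space p (power_weight \<alpha>)"
    by (rule Lp_bound(2)[OF f])
  show "AE x in lebesgue. hausdorff_op \<phi> (\<lambda>y. c * f y) x = c * hausdorff_op \<phi> f x" for c
    unfolding hausdorff_op_def hausdorff_integrand_def mult.assoc set_integral_mult_right by simp
  fix g assume g: "g \<in> Lp_space p (power_weight \<alpha>)"
  show "AE x in lebesgue. hausdorff_op \<phi> (\<lambda>y. f y + g y) x = hausdorff_op \<phi> f x + hausdorff_op \<phi> g x"
    using Lp_bound(1)[OF f] Lp_bound(1)[OF g]
  proof eventually_elim
    case (elim x)
    show ?case
      unfolding hausdorff_op_def set_integral_add(2)[OF elim, symmetric]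
      unfolding hausdorff_integrand_def distrib_right ..
  qed
  assume fg: "AE x in lebesgue. f x = g x"
  show "AE x in lebesgue. hausdorff_op \<phi> f x = hausdorff_op \<phi> g x"
    using nz Lp_bound(1)[OF f] Lp_bound(1)[OF g]
  proof eventually_elim
    case (elim x)
    \<comment> \<open>For x \<noteq> 0, null sets are preserved by t -> x/t. Integrability of both
      integrands then provides the measurability needed to equate the integrals.\<close>
    have "AE t in lebesgue. indicator {0<..} t *\<^sub>R hausdorff_integrand \<phi> f x t
        = indicator {0<..} t *\<^sub>R hausdorff_integrand \<phi> g x t"
      using AE_lebesgue_divide[OF fg elim(1)]
      by eventually_elim (auto simp: hausdorff_integrand_def indicator_def)
    then show ?case
      using elim unfolding hausdorff_op_def set_lebesgue_integral_def set_integrable_def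
      by (intro integral_cong_AE) auto
  qed
next
  show "\<exists>C. \<forall>f\<in>Lp_space p (power_weight \<alpha>).
      Lp_norm p (power_weight \<alpha>) (hausdorff_op \<phi> f) \<le> C * Lp_norm p (power_weight \<alpha>) f"
    using Lp_bound(3) by blast
qed

end

theorem corollary1p3:
  fixes p \<alpha> :: real and \<phi> :: "real \<Rightarrow> real"
  assumes "1 < p" and "\<alpha> > -1"
    and "\<phi> \<in> borel_measurable (lebesgue_on {0<..})"
    and "\<And>t. t > 0 \<Longrightarrow> \<phi> t \<ge> 0"
    and "set_integrable lebesgue {0<..} (\<lambda>t. t powr ((1 + \<alpha>) / p - 1) * \<bar>\<phi> t\<bar>)"
  shows "(\<forall>f \<in> Lp_space p (power_weight \<alpha>). AE x in power_weight \<alpha>.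
            set_integrable lebesgue {0<..} (hausdorff_integrand \<phi> f x)) \<and>
         bounded_on_Lp p (power_weight \<alpha>) (hausdorff_op \<phi>) \<and>
         Lp_onorm p (power_weight \<alpha>) (hausdorff_op \<phi>) =
           (LINT t:{0<..}|lebesgue. t powr ((1 + \<alpha>) / p - 1) * \<phi> t)"
proof -
  have "set_integrable lebesgue {0<..} (\<lambda>t. t powr ((1 + \<alpha>) / p - 1) * \<phi> t) \<longleftrightarrow>
      set_integrable lebesgue {0<..} (\<lambda>t. t powr ((1 + \<alpha>) / p - 1) * \<bar>\<phi> t\<bar>)"
    by (rule set_integrable_cong) (auto simp: assms(4))
  with assms interpret hausdorff_kernel p \<alpha> \<phi>
    by unfold_locales auto
  show ?thesis
    using Lp_bound(1) bounded Lp_onorm_eq by (simp add: AE_power_weight_iff mass_def)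
qed

end
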